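(* Let $p<q$ be square-free integers $\ge 2$ with $p\equiv 2\pmod 4$ and $q\equiv 3\pmod 4$, put $r=pq/\gcd(p,q)^2$ and assume $p<q<r$. Let $K=\mathbb{Q}(\sqrt p,\sqrt q)$. Let $m,t,\kappa$ be positive integers and let $$I_1=\left[\frac{m\kappa}{2t}+\frac{\sqrt m}{\sqrt t},\ \frac{m\kappa}{2(t-1)}-\frac{\sqrt m}{\sqrt{t-1}}\right]\ \text{ if } t>1,\qquad I_1=\left[\frac{m\kappa}{2}+\sqrt m,\ \infty\right)\ \text{ if } t=1.$$ If $m\le\min\{\frac{r}{4\lceil\kappa\sqrt r\rceil},\,p,\,q\}$ and $\sqrt p,\sqrt q\in I_1$, then not all elements of $m\mathcal{O}_K^+$ are sums of squares of elements of $\mathcal{O}_K$. Moreover, the interval $I_1$ is non-empty for $m\ge\frac{4t(t-1)\left(2t-1+2\sqrt{t(t-1)}\right)}{\kappa^2}$.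
   Context: $\mathcal{O}_K$ is the ring of integers of $K$, $\mathcal{O}_K^+$ is the set of its totally positive elements (all four real embeddings positive), and $m\mathcal{O}_K^+=\{m\alpha:\alpha\in\mathcal{O}_K^+\}$. A sum of squares in $\mathcal{O}_K$ is a finite sum $\sum_i\alpha_i^2$ with $\alpha_i\in\mathcal{O}_K$. *)

theory Defs
  imports Complex_Main "HOL-Algebra.Generated_Fields" "HOL-Algebra.Algebraic_Closure_Type"
    "HOL-Computational_Algebra.Squarefree"
begin

abbreviation real_ring :: "real ring" where
  "real_ring \<equiv> ring_of_type_algebra"

(* The field Q(sqrt p, sqrt q), realised inside the reals. *)
definition biquadratic_field :: "nat \<Rightarrow> nat \<Rightarrow> real set" where
  "biquadratic_field p q = generate_field real_ring {sqrt (real p), sqrt (real q)}"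

definition ring_of_integers :: "real set \<Rightarrow> real set" where
  "ring_of_integers K = {x \<in> K. algebraic_int x}"

(* Ring homomorphisms K -> R; the values of such a function outside K are arbitrary and irrelevant. *)
definition real_embeddings :: "real set \<Rightarrow> (real \<Rightarrow> real) set" where
  "real_embeddings K = ring_hom (real_ring\<lparr>carrier := K\<rparr>) real_ring"

definition totally_positive_integers :: "real set \<Rightarrow> real set" where
  "totally_positive_integers K =
     {x \<in> ring_of_integers K. \<forall>\<sigma> \<in> real_embeddings K. \<sigma> x > 0}"

definition sums_of_squares :: "real set \<Rightarrow> real set" where
  "sums_of_squares R = {\<Sum>x\<leftarrow>xs. x ^ 2 | xs. set xs \<subseteq> R}"

(* Meant for t \<ge> 1 only. *)
definition I1 :: "nat \<Rightarrow> nat \<Rightarrow> nat \<Rightarrow> real set" where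
  "I1 m t \<kappa> =
     (if t > 1
      then {real m * real \<kappa> / (2 * real t) + sqrt (real m) / sqrt (real t) ..
            real m * real \<kappa> / (2 * (real t - 1)) - sqrt (real m) / sqrt (real t - 1)}
      else {real m * real \<kappa> / 2 + sqrt (real m) ..})"

end

theory Submission
  imports Defs "HOL-Analysis.Convex"
begin

text \<open>With $n = \lceil\kappa\sqrt p\rceil$ the element $\alpha = n + \kappa\sqrt p$ is totally positive.
  Suppose $m\alpha = \sum_i (x_i + y_i\sqrt p + z_i\sqrt q + w_i\sqrt r)^2$ with integral summands.
  Since $\mathrm{Tr}(m\alpha)/4 = mn \le r/4$, and since $2y_i, 2w_i$ are integers of the same parity, all
  $w_i$ vanish, so the $y_i$ are integers and $2\sum x_i y_i = m\kappa$. Comparing with the conjugate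
  $\sqrt p \mapsto -\sqrt p$ gives $\sum (x_i - y_i\sqrt p)^2 < m$, whence by Cauchy--Schwarz
  $|m\kappa/2 - Y\sqrt p| < \sqrt{mY}$ for the positive integer $Y = \sum y_i^2$. The interval $I_1$ is
  exactly a gap between the solution sets of this inequality for $Y \le t - 1$ and for $Y \ge t$.

  The parity statement comes from traces and relative norms to the quadratic subfields. Closure of the
  algebraic integers under ring operations is replaced by bounded denominators: the powers of an
  algebraic integer of the field all lie in $D^{-1}$ times a fixed conjugation-invariant order.\<close>

section \<open>Almost integral elements\<close>

locale unital_subring =
  fixes A :: "'a :: field_char_0 set"
  assumes one_mem: "1 \<in> A"
    and minus_mem: "x \<in> A \<Longrightarrow> - x \<in> A"
    and add_mem: "x \<in> A \<Longrightarrow> y \<in> A \<Longrightarrow> x + y \<in> A"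
    and mult_mem: "x \<in> A \<Longrightarrow> y \<in> A \<Longrightarrow> x * y \<in> A"
begin

lemma zero_mem: "0 \<in> A"
  using add_mem[OF one_mem minus_mem[OF one_mem]] by simp

lemma of_nat_mem: "of_nat n \<in> A"
  by (induction n) (auto intro: zero_mem one_mem add_mem)

lemma Ints_subset: "\<int> \<subseteq> A"
proof
  fix x :: 'a assume "x \<in> \<int>"
  then obtain k where "x = of_int k" by (auto elim: Ints_cases)
  then show "x \<in> A"
    using of_nat_mem minus_mem[OF of_nat_mem] by (cases k rule: int_cases2) auto
qed

lemma sum_mem: "(\<And>i. i \<in> I \<Longrightarrow> f i \<in> A) \<Longrightarrow> sum f I \<in> A"
  by (induction I rule: infinite_finite_induct) (auto intro: zero_mem add_mem)

lemma power_mem: "x \<in> A \<Longrightarrow> x ^ n \<in> A"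
  by (induction n) (auto intro: one_mem mult_mem)

text \<open>Complete integrality over \<open>A\<close> with an integer denominator: one
  \<open>D\<close> must serve all powers. It passes to products by multiplying denominators, and to
  sums by the binomial theorem in the same way.\<close>

definition almost_integral :: "'a \<Rightarrow> bool" where
  "almost_integral x \<longleftrightarrow> (\<exists>D::nat. D > 0 \<and> (\<forall>n. of_nat D * x ^ n \<in> A))"

lemma almost_integral_mult:
  assumes "almost_integral x" "almost_integral y"
  shows "almost_integral (x * y)"
proof -
  from assms obtain D E :: nat where D: "D > 0" "\<And>n. of_nat D * x ^ n \<in> A"
    and E: "E > 0" "\<And>n. of_nat E * y ^ n \<in> A"
    by (auto simp: almost_integral_def)
  have "of_nat (D * E) * (x * y) ^ n = (of_nat D * x ^ n) * (of_nat E * y ^ n)" for n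
    by (simp add: power_mult_distrib)
  then have "\<And>n. of_nat (D * E) * (x * y) ^ n \<in> A"
    using D E by (metis mult_mem)
  then show ?thesis
    using D E unfolding almost_integral_def by (intro exI[of _ "D * E"]) auto
qed

lemma almost_integral_add:
  assumes "almost_integral x" "almost_integral y"
  shows "almost_integral (x + y)"
proof -
  from assms obtain D E :: nat where D: "D > 0" "\<And>n. of_nat D * x ^ n \<in> A"
    and E: "E > 0" "\<And>n. of_nat E * y ^ n \<in> A"
    by (auto simp: almost_integral_def)
  have "of_nat (D * E) * (x + y) ^ n
      = (\<Sum>k\<le>n. of_nat (n choose k) * ((of_nat D * x ^ k) * (of_nat E * y ^ (n - k))))" for n
    by (simp add: binomial_ring sum_distrib_left algebra_simps)
  moreover have "\<dots> n \<in> A" for n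
    by (intro sum_mem mult_mem[OF of_nat_mem mult_mem[OF D(2) E(2)]])
  ultimately have "\<And>n. of_nat (D * E) * (x + y) ^ n \<in> A"
    by simp
  then show ?thesis
    using D E unfolding almost_integral_def by (intro exI[of _ "D * E"]) auto
qed

text \<open>With \<open>d\<close> the degree of a monic equation, \<open>D ^ d\<close> clears
  \<open>x ^ n\<close> for \<open>n < d\<close>. The equation writes each higher power as an
  integral combination of lower ones, so the same denominator keeps working.\<close>

lemma algebraic_int_imp_almost_integral:
  assumes "algebraic_int x" "D > 0" "of_nat D * x \<in> A"
  shows "almost_integral x"
proof -
  from assms(1) obtain f where f: "lead_coeff f = 1" "\<And>i. coeff f i \<in> \<int>" "poly f x = 0"
    by (auto simp: algebraic_int.simps)
  define d where "d = degree f"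
  have root: "x ^ d = - (\<Sum>i<d. coeff f i * x ^ i)"
  proof -
    have "(\<Sum>i\<le>d. coeff f i * x ^ i) = 0"
      using f(3) by (simp add: poly_altdef d_def)
    then show ?thesis
      using f(1) by (simp add: lessThan_Suc_atMost[symmetric] d_def eq_neg_iff_add_eq_0 add.commute)
  qed
  have "of_nat (D ^ d) * x ^ n \<in> A" for n
  proof (induction n rule: less_induct)
    case (less n)
    show ?case
    proof (cases "n < d")
      case True
      then have "of_nat (D ^ d) * x ^ n = of_nat (D ^ (d - n)) * (of_nat D * x) ^ n"
        by (simp add: power_mult_distrib mult.assoc[symmetric] power_add[symmetric])
      then show ?thesis
        using assms(3) by (metis mult_mem of_nat_mem power_mem)
    next
      case False
      then have "x ^ n = x ^ (n - d) * x ^ d"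
        by (simp add: power_add[symmetric])
      also have "\<dots> = - (\<Sum>i<d. coeff f i * x ^ (n - d + i))"
        by (simp add: root sum_distrib_left power_add algebra_simps)
      finally have "of_nat (D ^ d) * x ^ n
          = - (\<Sum>i<d. coeff f i * (of_nat (D ^ d) * x ^ (n - d + i)))"
        by (simp add: sum_distrib_left algebra_simps)
      moreover have "coeff f i * (of_nat (D ^ d) * x ^ (n - d + i)) \<in> A" if "i < d" for i
        using that False less.IH[of "n - d + i"] by (intro mult_mem[OF subsetD[OF Ints_subset f(2)]]) auto
      ultimately show ?thesis
        by (auto intro!: minus_mem sum_mem)
    qed
  qed
  then show ?thesis
    using assms(2) unfolding almost_integral_def by (intro exI[of _ "D ^ d"]) auto
qed

end

text \<open>In lowest terms every power of the denominator \<open>b\<close> divides the fixed number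
  \<open>D\<close>, which forces \<open>b = 1\<close>.\<close>

lemma Rats_bounded_denominators_imp_Ints:
  fixes x :: "'a :: field_char_0"
  assumes "x \<in> \<rat>" "D > 0" "\<And>n. of_nat D * x ^ n \<in> \<int>"
  shows "x \<in> \<int>"
proof -
  from assms(1) obtain a b where ab: "b > 0" "Rings.coprime a b" "x = of_int a / of_int b"
    by (auto elim: Rats_cases')
  have "b ^ n dvd int D" for n
  proof -
    obtain k where k: "of_nat D * x ^ n = of_int k"
      using assms(3)[of n] by (auto elim: Ints_cases)
    then have "of_int (int D * a ^ n) = (of_int (k * b ^ n) :: 'a)"
      using ab by (simp add: field_simps power_divide)
    then have "int D * a ^ n = k * b ^ n"
      by (simp only: of_int_eq_iff)
    then have "b ^ n dvd int D * a ^ n" by simp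
    then show ?thesis
      using ab(2) by (metis coprime_commute coprime_dvd_mult_left_iff coprime_power_left_iff coprime_power_right_iff)
  qed
  \<comment> \<open>The exponent \<open>D\<close> is large enough because
    \<open>D < 2 ^ D\<close>.\<close>
  then have "b ^ D \<le> int D"
    using assms(2) by (intro zdvd_imp_le) auto
  moreover have "int D < 2 ^ D" by (metis of_nat_less_two_power)
  ultimately have "b ^ D < 2 ^ D" by linarith
  then have "b < 2" by (meson power_less_imp_less_base zero_le_numeral)
  then show ?thesis using ab by (cases "b = 1") auto
qed

section \<open>Biquadratic fields\<close>

lemma int_square_mod_4: "(u :: int)\<^sup>2 mod 4 = (if even u then 0 else 1)"
proof (cases "even u")
  case True
  then obtain v where "u = 2 * v" by (elim evenE)
  then have "u\<^sup>2 = 4 * v\<^sup>2" by (simp add: power2_eq_square)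
  then show ?thesis using True by simp
next
  case False
  then obtain v where "u = 2 * v + 1" by (elim oddE)
  then have "u\<^sup>2 = 4 * (v\<^sup>2 + v) + 1" by (simp add: power2_eq_square algebra_simps)
  then show ?thesis using False by presburger
qed

lemma int_eq_4_mult_plus_mod: "\<exists>c. int n = 4 * c + int (n mod 4)"
  by (intro exI[of _ "int (n div 4)"]) (simp add: zmod_int zdiv_int)

lemma int_mod_4_if_cases:
  assumes "(k :: int) mod 4 = (if P then 0 else 1)"
  obtains v where "P" "k = 4 * v" | v where "\<not> P" "k = 4 * v + 1"
  using assms mult_div_mod_eq[of 4 k] by (metis add.right_neutral)

text \<open>\<open>k\<close> and \<open>l\<close> stand for squares, \<open>P\<close> and
  \<open>Q\<close> for evenness of their roots. The two alternatives express that 4 divides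
  \<open>k - n * l\<close> when \<open>n\<close> is 2 or 3 modulo 4.\<close>

lemma mod_4_parity_quadratic:
  assumes "(k :: int) mod 4 = (if P then 0 else 1)" "l mod 4 = (if Q then 0 else 1)"
    and "k - 2 * l = 4 * M \<or> k + l = 4 * M"
  shows "P \<and> Q"
  using assms(1)
  by (cases rule: int_mod_4_if_cases; use assms(2) in \<open>cases rule: int_mod_4_if_cases\<close>;
      use assms(3) in simp; presburger)

text \<open>\<open>h\<close> and \<open>i\<close> stand for squares. They agree modulo 2, hence
  modulo 4 since only the residues 0 and 1 occur, and so 4 divides
  \<open>2 * (k + l)\<close>.\<close>

lemma mod_4_parity_quartic:
  assumes "(h :: int) mod 4 = (if P then 0 else 1)" "i mod 4 = (if Q then 0 else 1)"
    and "h - 2 * k - i - 2 * l = 4 * M"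
  shows "even (k + l)"
proof -
  have "h - i = 2 * (2 * M + k + l)" using assms(3) by simp
  then have "even (h - i)" by (metis dvd_triv_left)
  obtain e where e: "h = 4 * e + (if P then 0 else 1)"
    using assms(1) by (metis mult_div_mod_eq)
  obtain f where f: "i = 4 * f + (if Q then 0 else 1)"
    using assms(2) by (metis mult_div_mod_eq)
  have "P = Q" using e f \<open>even (h - i)\<close> by (auto split: if_splits)
  then have "k + l = 2 * (e - f - M)" using e f assms(3) by (auto split: if_splits)
  then show ?thesis by simp
qed

lemma sqrt_not_Rats:
  assumes "n mod 4 \<in> {2, 3}"
  shows "sqrt (real n) \<notin> \<rat>"
proof
  assume "sqrt (real n) \<in> \<rat>"
  then have "sqrt (real n) \<in> \<int>"
    by (intro rational_algebraic_int_is_int algebraic_int_sqrt) auto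
  then obtain k where k: "sqrt (real n) = of_int k" by (auto elim: Ints_cases)
  have "real n = (sqrt (real n))\<^sup>2" by simp
  also have "\<dots> = of_int (k\<^sup>2)" by (simp add: k)
  finally have "int n = k\<^sup>2" by (metis of_int_eq_iff of_int_of_nat_eq)
  moreover have "int n mod 4 = 2 \<or> int n mod 4 = 3"
  proof -
    have "n mod 4 = 2 \<or> n mod 4 = 3" using assms by auto
    then show ?thesis by presburger
  qed
  ultimately show False using int_square_mod_4[of k] by (auto split: if_splits)
qed

lemma Rats_eq_0_if_square_eq:
  fixes x y :: real
  assumes "n mod 4 \<in> {2, 3}" "x \<in> \<rat>" "y \<in> \<rat>" "x\<^sup>2 = real n * y\<^sup>2"
  shows "x = 0 \<and> y = 0"
proof -
  have "y = 0"
  proof (rule ccontr)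
    assume "y \<noteq> 0"
    have "\<bar>x\<bar> = sqrt (real n) * \<bar>y\<bar>"
      using arg_cong[OF assms(4), of sqrt] by (simp add: real_sqrt_mult)
    then have "sqrt (real n) = \<bar>x\<bar> / \<bar>y\<bar>"
      using \<open>y \<noteq> 0\<close> by (simp add: field_simps)
    then have "sqrt (real n) \<in> \<rat>" using assms by simp
    then show False using sqrt_not_Rats[OF assms(1)] by simp
  qed
  then show ?thesis using assms by simp
qed

text \<open>In lowest terms the square of the denominator divides \<open>n\<close>, so the
  denominator is 1.\<close>

lemma squarefree_mult_square_Ints:
  fixes x :: real
  assumes "squarefree n" "x \<in> \<rat>" "real n * x\<^sup>2 \<in> \<int>"
  shows "x \<in> \<int>"
proof -
  from assms(2) obtain a b where ab: "b > 0" "Rings.coprime a b" "x = of_int a / of_int b"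
    by (auto elim: Rats_cases')
  obtain k where k: "real n * x\<^sup>2 = of_int k" using assms(3) by (auto elim: Ints_cases)
  then have "of_int (int n * a\<^sup>2) = (of_int (k * b\<^sup>2) :: real)"
    using ab by (simp add: field_simps power_divide)
  then have "int n * a\<^sup>2 = k * b\<^sup>2" by (simp only: of_int_eq_iff)
  then have "b\<^sup>2 dvd int n * a\<^sup>2" by simp
  then have "b\<^sup>2 dvd int n"
    using ab(2) by (metis coprime_commute coprime_dvd_mult_left_iff coprime_power_left_iff coprime_power_right_iff)
  then have "(nat b)\<^sup>2 dvd n"
    using ab(1) by (metis int_dvd_int_iff int_nat_eq less_le nat_0_le of_nat_power)
  then have "nat b dvd 1" using assms(1) by (auto dest: squarefreeD)
  then have "b = 1" using ab(1) by simp
  then show ?thesis using ab by simp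
qed

text \<open>This is the description of the integers of a quadratic field without half-integers.
  Eliminating \<open>x\<close> between trace and norm makes \<open>2 * y\<close> integral; the norm
  equation modulo 4 then forces both doubled coordinates to be even.\<close>

lemma quadratic_integer_Ints:
  fixes x y :: real
  assumes n: "squarefree n" "n mod 4 \<in> {2, 3}" and "x \<in> \<rat>" "y \<in> \<rat>"
    and trace: "2 * x \<in> \<int>" and norm: "x\<^sup>2 - real n * y\<^sup>2 \<in> \<int>"
  shows "x \<in> \<int> \<and> y \<in> \<int>"
proof -
  have "real n * (2 * y)\<^sup>2 = (2 * x)\<^sup>2 - 4 * (x\<^sup>2 - real n * y\<^sup>2)"
    by (simp add: power2_eq_square algebra_simps)
  also have "\<dots> \<in> \<int>" by (intro Ints_diff Ints_power trace Ints_mult[OF _ norm]) auto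
  finally have "real n * (2 * y)\<^sup>2 \<in> \<int>" .
  then have "2 * y \<in> \<int>"
    by (rule squarefree_mult_square_Ints[OF n(1) Rats_mult[OF Rats_number_of assms(4)]])
  then obtain k l j where kl: "2 * x = of_int k" "2 * y = of_int l" "x\<^sup>2 - real n * y\<^sup>2 = of_int j"
    using trace norm by (auto elim!: Ints_cases)
  have "of_int (k\<^sup>2 - int n * l\<^sup>2) = (2 * x)\<^sup>2 - real n * (2 * y)\<^sup>2"
    by (simp add: kl)
  also have "\<dots> = of_int (4 * j)"
    unfolding of_int_mult kl(3)[symmetric] by (simp add: power2_eq_square algebra_simps)
  finally have eq: "k\<^sup>2 - int n * l\<^sup>2 = 4 * j" by (simp only: of_int_eq_iff)
  have "n mod 4 = 2 \<or> n mod 4 = 3" using n(2) by simp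
  moreover obtain c where "int n = 4 * c + int (n mod 4)"
    using int_eq_4_mult_plus_mod by blast
  ultimately have c: "int n = 4 * c + 2 \<or> int n = 4 * c + 3" by auto
  have "k\<^sup>2 - 2 * l\<^sup>2 = 4 * (j + c * l\<^sup>2) \<or> k\<^sup>2 + l\<^sup>2 = 4 * (j + c * l\<^sup>2 + l\<^sup>2)"
    using c
  proof
    assume "int n = 4 * c + 2"
    then show ?thesis using eq by (simp add: algebra_simps)
  next
    assume "int n = 4 * c + 3"
    then show ?thesis using eq by (simp add: algebra_simps)
  qed
  then obtain M where mod4: "k\<^sup>2 - 2 * l\<^sup>2 = 4 * M \<or> k\<^sup>2 + l\<^sup>2 = 4 * M" by blast
  have "even k \<and> even l"
    using mod_4_parity_quadratic[OF int_square_mod_4 int_square_mod_4 mod4] .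
  then obtain k' l' where "k = 2 * k'" "l = 2 * l'" by (auto elim!: evenE)
  then have "x = of_int k'" "y = of_int l'" using kl by auto
  then show ?thesis by simp
qed

section \<open>Coordinates in the biquadratic field\<close>

lemma arg_cong4: "x = x' \<Longrightarrow> y = y' \<Longrightarrow> z = z' \<Longrightarrow> w = w' \<Longrightarrow> f x y z w = f x' y' z' w'"
  by simp

text \<open>\<open>g\<close> is to be the gcd of \<open>p\<close> and \<open>q\<close>, with
  cofactors \<open>a\<close> and \<open>b\<close>. The residues make
  \<open>quadratic_integer_Ints\<close> applicable to all three quadratic subfields.\<close>

locale biquadratic =
  fixes g a b :: nat
  assumes squarefree_ga: "squarefree (g * a)" and squarefree_gb: "squarefree (g * b)"
    and squarefree_ab: "squarefree (a * b)"
    and ga_mod: "(g * a) mod 4 = 2" and gb_mod: "(g * b) mod 4 = 3" and ab_mod: "(a * b) mod 4 = 2"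
begin

text \<open>With \<open>p = g a\<close>, \<open>q = g b\<close>, \<open>r = a b\<close> the multiplication table of the square roots is free of divisions.\<close>
definition elt :: "real \<Rightarrow> real \<Rightarrow> real \<Rightarrow> real \<Rightarrow> real" where
  "elt x y z w = x + y * sqrt (real (g * a)) + z * sqrt (real (g * b)) + w * sqrt (real (a * b))"

text \<open>\<open>elts \<rat>\<close> serves as the ambient field, \<open>elts \<int>\<close> as
  the conjugation-invariant order in which bounded denominators are measured.\<close>

definition elts :: "real set \<Rightarrow> real set" where
  "elts S = {elt x y z w | x y z w. x \<in> S \<and> y \<in> S \<and> z \<in> S \<and> w \<in> S}"

lemma eltsI: "x \<in> S \<Longrightarrow> y \<in> S \<Longrightarrow> z \<in> S \<Longrightarrow> w \<in> S \<Longrightarrow> elt x y z w \<in> elts S"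
  by (auto simp: elts_def)

lemma eltsE:
  assumes "u \<in> elts S"
  obtains x y z w where "u = elt x y z w" "x \<in> S" "y \<in> S" "z \<in> S" "w \<in> S"
  using assms by (auto simp: elts_def)

lemma sqrt_mult_rules:
  "sqrt (real (g * a)) * sqrt (real (g * a)) = g * a" "sqrt (real (g * b)) * sqrt (real (g * b)) = g * b"
  "sqrt (real (a * b)) * sqrt (real (a * b)) = a * b"
  "sqrt (real (g * a)) * sqrt (real (g * b)) = g * sqrt (real (a * b))"
  "sqrt (real (g * a)) * sqrt (real (a * b)) = a * sqrt (real (g * b))"
  "sqrt (real (g * b)) * sqrt (real (a * b)) = b * sqrt (real (g * a))"
  by (simp_all add: real_sqrt_mult algebra_simps)

lemma elt_mult:
  fixes x y z w x' y' z' w' :: real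
  shows "elt x y z w * elt x' y' z' w' =
    elt (x * x' + g * a * (y * y') + g * b * (z * z') + a * b * (w * w'))
        (x * y' + y * x' + b * (z * w' + w * z'))
        (x * z' + z * x' + a * (y * w' + w * y'))
        (x * w' + w * x' + g * (y * z' + z * y'))"
proof -
  \<comment> \<open>The product is expanded over indeterminate \<open>s1\<close>, \<open>s2\<close>,
    \<open>s3\<close> first; the multiplication table of the roots is inserted afterwards.\<close>
  have "(x + y * s1 + z * s2 + w * s3) * (x' + y' * s1 + z' * s2 + w' * s3)
    = x * x' + y * y' * (s1 * s1) + z * z' * (s2 * s2) + w * w' * (s3 * s3)
      + (x * y' + y * x') * s1 + (z * w' + w * z') * (s2 * s3)
      + (x * z' + z * x') * s2 + (y * w' + w * y') * (s1 * s3)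
      + (x * w' + w * x') * s3 + (y * z' + z * y') * (s1 * s2)" for s1 s2 s3 :: real
    by (simp add: algebra_simps)
  note this[of "sqrt (real (g * a))" "sqrt (real (g * b))" "sqrt (real (a * b))"]
  then show ?thesis
    unfolding elt_def sqrt_mult_rules by (simp add: algebra_simps)
qed

lemma elt_add: "elt x y z w + elt x' y' z' w' = elt (x + x') (y + y') (z + z') (w + w')"
  and elt_minus: "- elt x y z w = elt (- x) (- y) (- z) (- w)"
  and elt_scale: "c * elt x y z w = elt (c * x) (c * y) (c * z) (c * w)"
  by (simp_all add: elt_def algebra_simps)

lemma elt_sum: "(\<Sum>i\<in>I. elt (x i) (y i) (z i) (w i)) = elt (sum x I) (sum y I) (sum z I) (sum w I)"
  by (simp add: elt_def sum.distrib sum_distrib_right)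

lemma elt_rational: "elt x 0 0 0 = x"
  by (simp add: elt_def)

lemma quadratic_eq_0:
  assumes "n mod 4 \<in> {2, 3}" "x \<in> \<rat>" "y \<in> \<rat>" "x + y * sqrt (real n) = 0"
  shows "x = 0 \<and> y = 0"
proof -
  have "x = - (y * sqrt (real n))" using assms(4) by linarith
  then have "x\<^sup>2 = real n * y\<^sup>2" by (simp add: power_mult_distrib)
  then show ?thesis using Rats_eq_0_if_square_eq assms by blast
qed

text \<open>The products of a vanishing element with its conjugates over two quadratic subfields
  vanish too, which gives enough equations between squares.\<close>
lemma elt_eq_0:
  assumes "x \<in> \<rat>" "y \<in> \<rat>" "z \<in> \<rat>" "w \<in> \<rat>" "elt x y z w = 0"
  shows "x = 0 \<and> y = 0 \<and> z = 0 \<and> w = 0"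
proof -
  have ga: "(x\<^sup>2 + g * a * y\<^sup>2 - g * b * z\<^sup>2 - a * b * w\<^sup>2) + (2 * x * y - 2 * b * z * w) * sqrt (real (g * a)) = 0"
  proof -
    have "elt x y z w * elt x y (- z) (- w) = 0" using assms by simp
    then show ?thesis unfolding elt_mult by (simp add: elt_def power2_eq_square algebra_simps)
  qed
  have gb: "(x\<^sup>2 - g * a * y\<^sup>2 + g * b * z\<^sup>2 - a * b * w\<^sup>2) + (2 * x * z - 2 * a * y * w) * sqrt (real (g * b)) = 0"
  proof -
    have "elt x y z w * elt x (- y) z (- w) = 0" using assms by simp
    then show ?thesis unfolding elt_mult by (simp add: elt_def power2_eq_square algebra_simps)
  qed
  have 1: "x\<^sup>2 + g * a * y\<^sup>2 - g * b * z\<^sup>2 - a * b * w\<^sup>2 = 0"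
    using assms ga_mod by (intro conjunct1[OF quadratic_eq_0[OF _ _ _ ga]]) auto
  have 2: "x\<^sup>2 - g * a * y\<^sup>2 + g * b * z\<^sup>2 - a * b * w\<^sup>2 = 0"
    using assms gb_mod by (intro conjunct1[OF quadratic_eq_0[OF _ _ _ gb]]) auto
  \<comment> \<open>This is half the sum of the two equations; irrationality of the root of
    \<open>a * b\<close> kills \<open>x\<close> and \<open>w\<close>.\<close>
  have "x\<^sup>2 = real (a * b) * w\<^sup>2" using 1 2 by simp
  then have xw: "x = 0" "w = 0"
    using Rats_eq_0_if_square_eq[of "a * b" x w] ab_mod assms by auto
  then have "real (g * a) * y\<^sup>2 = real (g * b) * z\<^sup>2" using 1 by simp
  then have "a * y\<^sup>2 = b * z\<^sup>2" using ga_mod by auto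
  \<comment> \<open>Multiplying by \<open>b\<close> turns the equation into one governed by the same
    irrational root.\<close>
  then have "(b * z)\<^sup>2 = real (a * b) * y\<^sup>2" by (simp add: power2_eq_square algebra_simps)
  then have "b * z = 0 \<and> y = 0"
    using Rats_eq_0_if_square_eq[of "a * b" "b * z" y] ab_mod assms by auto
  then show ?thesis using xw gb_mod by auto
qed

lemma elt_inject:
  assumes "x \<in> \<rat>" "y \<in> \<rat>" "z \<in> \<rat>" "w \<in> \<rat>" "x' \<in> \<rat>" "y' \<in> \<rat>" "z' \<in> \<rat>" "w' \<in> \<rat>"
    and "elt x y z w = elt x' y' z' w'"
  shows "x = x' \<and> y = y' \<and> z = z' \<and> w = w'"
proof -
  have "elt (x - x') (y - y') (z - z') (w - w') = 0"
    using assms by (simp add: elt_def algebra_simps)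
  then show ?thesis using elt_eq_0[of "x - x'" "y - y'" "z - z'" "w - w'"] assms by simp
qed

text \<open>\<open>A\<close> and \<open>B\<close> are the coordinates of the relative norm of
  \<open>u\<close> to the subfield of the root of \<open>g * a\<close>, and \<open>N\<close> is the
  absolute norm. Linear independence keeps all conjugates nonzero, so dividing the product of the
  other factors by \<open>N\<close> gives the inverse.\<close>

lemma elts_inverse:
  assumes "u \<in> elts \<rat>" "u \<noteq> 0"
  shows "inverse u \<in> elts \<rat>"
proof -
  from assms(1) obtain x y z w where u: "u = elt x y z w" and Q: "x \<in> \<rat>" "y \<in> \<rat>" "z \<in> \<rat>" "w \<in> \<rat>"
    by (rule eltsE)
  define A where "A = x\<^sup>2 + g * a * y\<^sup>2 - g * b * z\<^sup>2 - a * b * w\<^sup>2"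
  define B where "B = 2 * x * y - 2 * b * z * w"
  define N where "N = A\<^sup>2 - g * a * B\<^sup>2"
  have AB: "A \<in> \<rat>" "B \<in> \<rat>" "N \<in> \<rat>"
    using Q by (auto simp: A_def B_def N_def)
  have 1: "u * elt x y (- z) (- w) = elt A B 0 0"
    unfolding u elt_mult A_def B_def by (simp add: power2_eq_square algebra_simps)
  have 2: "elt A B 0 0 * elt A (- B) 0 0 = N"
    unfolding elt_mult N_def by (simp add: elt_def power2_eq_square algebra_simps)
  have "elt x y (- z) (- w) \<noteq> 0"
    using elt_eq_0[of x y "- z" "- w"] Q u assms(2) by (auto simp: elt_def)
  then have "elt A B 0 0 \<noteq> 0" using 1 assms(2) by (metis mult_eq_0_iff)
  moreover from this have "elt A (- B) 0 0 \<noteq> 0"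
    using elt_eq_0[of A "- B" 0 0] AB by (auto simp: elt_def)
  ultimately have "N \<noteq> 0" using 2 by (metis mult_eq_0_iff)
  have "u * (elt x y (- z) (- w) * elt A (- B) 0 0) = N"
    using 1 2 by (metis mult.assoc)
  then have "inverse u = inverse N * (elt x y (- z) (- w) * elt A (- B) 0 0)"
    using \<open>N \<noteq> 0\<close> assms(2) by (simp add: field_simps)
  also have "\<dots> \<in> elts \<rat>"
    unfolding elt_mult unfolding elt_scale using Q AB by (intro eltsI) auto
  finally show ?thesis .
qed

lemma unital_subring_elts:
  assumes "S = \<rat> \<or> S = \<int>"
  shows "unital_subring (elts S)"
proof
  show "1 \<in> elts S"
    using eltsI[of 1 S 0 0 0] assms by (auto simp: elt_rational)
  fix u assume "u \<in> elts S"
  then obtain x y z w where u: "u = elt x y z w" "x \<in> S" "y \<in> S" "z \<in> S" "w \<in> S"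
    by (rule eltsE)
  show "- u \<in> elts S"
    using u assms by (auto simp: elt_minus intro!: eltsI)
  fix v assume "v \<in> elts S"
  then obtain x' y' z' w' where v: "v = elt x' y' z' w'" "x' \<in> S" "y' \<in> S" "z' \<in> S" "w' \<in> S"
    by (rule eltsE)
  show "u + v \<in> elts S"
    unfolding u(1) v(1) elt_add using u v assms by (intro eltsI) auto
  show "u * v \<in> elts S"
    unfolding u(1) v(1) elt_mult using u v assms by (intro eltsI) auto
qed

sublocale L: unital_subring "elts \<int>"
  by (rule unital_subring_elts) simp

sublocale Q: unital_subring "elts \<rat>"
  by (rule unital_subring_elts) simp

lemma elts_rat_multiple:
  assumes "u \<in> elts \<rat>"
  shows "\<exists>D>0. of_nat D * u \<in> elts \<int>"
proof -
  have clear: "\<exists>D>0. of_nat D * x \<in> \<int>" if "x \<in> \<rat>" for x :: real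
  proof -
    from that obtain c d where "d > 0" "x = of_int c / of_int d"
      by (auto elim: Rats_cases')
    then show ?thesis by (intro exI[of _ "nat d"]) auto
  qed
  from assms obtain x y z w where u: "u = elt x y z w" and Q: "x \<in> \<rat>" "y \<in> \<rat>" "z \<in> \<rat>" "w \<in> \<rat>"
    by (rule eltsE)
  obtain D1 D2 D3 D4 :: nat where D: "D1 > 0" "D2 > 0" "D3 > 0" "D4 > 0"
    "D1 * x \<in> \<int>" "D2 * y \<in> \<int>" "D3 * z \<in> \<int>" "D4 * w \<in> \<int>"
    using clear Q by metis
  have "real (D1 * D2 * D3 * D4) * u = elt (real (D2 * D3 * D4) * (D1 * x)) (real (D1 * D3 * D4) * (D2 * y))
      (real (D1 * D2 * D4) * (D3 * z)) (real (D1 * D2 * D3) * (D4 * w))"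
    unfolding u elt_scale by (simp add: algebra_simps)
  also have "\<dots> \<in> elts \<int>"
    by (intro eltsI Ints_mult[OF Ints_of_nat D(5)] Ints_mult[OF Ints_of_nat D(6)]
        Ints_mult[OF Ints_of_nat D(7)] Ints_mult[OF Ints_of_nat D(8)])
  finally show ?thesis using D by (intro exI[of _ "D1 * D2 * D3 * D4"]) auto
qed

section \<open>Conjugates and half-integral coordinates\<close>

text \<open>For signs \<open>s\<close> and \<open>t\<close> this is the graph of the Galois
  automorphism that multiplies the roots of \<open>g * a\<close> and \<open>g * b\<close> by
  \<open>s\<close> and \<open>t\<close>; the third root then acquires \<open>s * t\<close>.\<close>

definition conj_pair :: "int \<Rightarrow> int \<Rightarrow> real \<Rightarrow> real \<Rightarrow> bool" where
  "conj_pair s t u v \<longleftrightarrow> (\<exists>x y z w. x \<in> \<rat> \<and> y \<in> \<rat> \<and> z \<in> \<rat> \<and> w \<in> \<rat> \<and>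
     u = elt x y z w \<and> v = elt x (of_int s * y) (of_int t * z) (of_int (s * t) * w))"

lemma conj_pairE:
  assumes "conj_pair s t u v"
  obtains x y z w where "x \<in> \<rat>" "y \<in> \<rat>" "z \<in> \<rat>" "w \<in> \<rat>"
    "u = elt x y z w" "v = elt x (of_int s * y) (of_int t * z) (of_int (s * t) * w)"
  using assms unfolding conj_pair_def by blast

lemma conj_pair_of_nat: "conj_pair s t (of_nat n) (of_nat n)"
  unfolding conj_pair_def
  by (intro exI[of _ "of_nat n"] exI[of _ 0]) (simp add: elt_rational)

text \<open>The signs match the multiplication table: a product of the second and third roots, for
  example, acquires \<open>t * (s * t) = s\<close>, the sign of the first root.\<close>

lemma conj_pair_mult:
  assumes "s\<^sup>2 = 1" "t\<^sup>2 = 1" "conj_pair s t u v" "conj_pair s t u' v'"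
  shows "conj_pair s t (u * u') (v * v')"
proof -
  obtain x y z w where
    Q: "x \<in> \<rat>" "y \<in> \<rat>" "z \<in> \<rat>" "w \<in> \<rat>" and
    u: "u = elt x y z w" "v = elt x (of_int s * y) (of_int t * z) (of_int (s * t) * w)"
    using assms(3) by (rule conj_pairE)
  obtain x' y' z' w' where
    Q': "x' \<in> \<rat>" "y' \<in> \<rat>" "z' \<in> \<rat>" "w' \<in> \<rat>" and
    u': "u' = elt x' y' z' w'" "v' = elt x' (of_int s * y') (of_int t * z') (of_int (s * t) * w')"
    using assms(4) by (rule conj_pairE)
  have st: "s = 1 \<or> s = -1" "t = 1 \<or> t = -1" using assms(1,2) by (simp_all add: power2_eq_1_iff)
  define A where "A = x * x' + g * a * (y * y') + g * b * (z * z') + a * b * (w * w')"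
  define B where "B = x * y' + y * x' + b * (z * w' + w * z')"
  define C where "C = x * z' + z * x' + a * (y * w' + w * y')"
  define E where "E = x * w' + w * x' + g * (y * z' + z * y')"
  have "u * u' = elt A B C E"
    unfolding u u' elt_mult A_def B_def C_def E_def ..
  moreover have "v * v' = elt A (of_int s * B) (of_int t * C) (of_int (s * t) * E)"
    unfolding u u' elt_mult A_def B_def C_def E_def
    by (intro arg_cong4[of _ _ _ _ _ _ _ _ elt]; use st in \<open>elim disjE; simp add: algebra_simps\<close>)
  moreover have "A \<in> \<rat>" "B \<in> \<rat>" "C \<in> \<rat>" "E \<in> \<rat>"
    using Q Q' by (auto simp: A_def B_def C_def E_def)
  ultimately show ?thesis
    unfolding conj_pair_def by blast
qed

lemma conj_pair_power:
  assumes "s\<^sup>2 = 1" "t\<^sup>2 = 1" "conj_pair s t u v"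
  shows "conj_pair s t (u ^ n) (v ^ n)"
  using conj_pair_of_nat[of s t 1] by (induction n) (auto intro: conj_pair_mult assms)

text \<open>Rational coordinates are unique, so those witnessing the relation are already integral,
  and integer factors keep them so.\<close>

lemma conj_pair_lattice:
  assumes "conj_pair s t u v" "u \<in> elts \<int>"
  shows "v \<in> elts \<int>"
proof -
  obtain x y z w where
    Q: "x \<in> \<rat>" "y \<in> \<rat>" "z \<in> \<rat>" "w \<in> \<rat>" and
    u: "u = elt x y z w" "v = elt x (of_int s * y) (of_int t * z) (of_int (s * t) * w)"
    using assms(1) by (rule conj_pairE)
  from assms(2) obtain x' y' z' w' where
    I: "x' \<in> \<int>" "y' \<in> \<int>" "z' \<in> \<int>" "w' \<in> \<int>" and u': "u = elt x' y' z' w'"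
    by (rule eltsE)
  have "x = x' \<and> y = y' \<and> z = z' \<and> w = w'"
    using u u' Q I Ints_subset_Rats by (intro elt_inject) auto
  then show ?thesis using I u by (auto intro!: eltsI Ints_mult)
qed

text \<open>The same \<open>D\<close> serves the conjugate, because \<open>D * u ^ n\<close> is
  paired with \<open>D * v ^ n\<close>.\<close>

lemma almost_integral_conj:
  assumes "s\<^sup>2 = 1" "t\<^sup>2 = 1" "conj_pair s t u v" "L.almost_integral u"
  shows "L.almost_integral v"
  using assms unfolding L.almost_integral_def
  by (meson conj_pair_lattice conj_pair_mult conj_pair_power conj_pair_of_nat)

text \<open>By uniqueness of coordinates a rational element of \<open>elts \<int>\<close> is an
  integer, which leaves the case of bounded denominators over the integers.\<close>

lemma almost_integral_rational:
  assumes "L.almost_integral u" "u \<in> \<rat>"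
  shows "u \<in> \<int>"
proof -
  from assms obtain D :: nat where D: "D > 0" "\<And>n. D * u ^ n \<in> elts \<int>"
    by (auto simp: L.almost_integral_def)
  have "D * u ^ n \<in> \<int>" for n
  proof -
    obtain x y z w where I: "x \<in> \<int>" "y \<in> \<int>" "z \<in> \<int>" "w \<in> \<int>" and u: "D * u ^ n = elt x y z w"
      using D(2)[of n] by (rule eltsE)
    have "D * u ^ n = x"
    proof -
      have "D * u ^ n \<in> \<rat>" using assms(2) by simp
      note this Rats_0 Rats_0 Rats_0 I[THEN subsetD[OF Ints_subset_Rats]]
      from elt_inject[OF this] show ?thesis using u by (simp add: elt_rational)
    qed
    then show ?thesis using I by simp
  qed
  then show ?thesis
    using Rats_bounded_denominators_imp_Ints[OF assms(2) D(1)] by blast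
qed

lemma quadratic_almost_integral:
  assumes "squarefree n" "n mod 4 \<in> {2, 3}" "x \<in> \<rat>" "y \<in> \<rat>"
    and "L.almost_integral (x + y * sqrt (real n))" "L.almost_integral (x - y * sqrt (real n))"
  shows "x \<in> \<int> \<and> y \<in> \<int>"
proof (rule quadratic_integer_Ints)
  show "2 * x \<in> \<int>"
    using L.almost_integral_add[OF assms(5,6)] assms(3) by (intro almost_integral_rational) auto
  have "(x + y * sqrt (real n)) * (x - y * sqrt (real n)) = x\<^sup>2 - real n * y\<^sup>2"
    by (simp add: algebra_simps power2_eq_square)
  then show "x\<^sup>2 - real n * y\<^sup>2 \<in> \<int>"
    using L.almost_integral_mult[OF assms(5,6)] assms(3,4) by (intro almost_integral_rational) auto
qed (use assms in auto)

text \<open>Relative traces to the three quadratic subfields make all doubled coordinates integral.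
  The relative norm to the subfield of the root of \<open>g * b\<close> then supplies an equation
  modulo 4 that ties \<open>k\<close> to \<open>l\<close>.\<close>

lemma integer_coordinates:
  assumes Q: "x \<in> \<rat>" "y \<in> \<rat>" "z \<in> \<rat>" "w \<in> \<rat>" and "algebraic_int (elt x y z w)"
  obtains k l where "2 * y = of_int k" "2 * w = of_int l" "even (k - l)"
proof -
  define u where "u s t = elt x (of_int s * y) (of_int t * z) (of_int (s * t) * w)" for s t :: int
  obtain D where "D > 0" "of_nat D * elt x y z w \<in> elts \<int>"
    using elts_rat_multiple eltsI[OF Q] by blast
  then have "L.almost_integral (elt x y z w)"
    using assms L.algebraic_int_imp_almost_integral by blast
  moreover have "conj_pair s t (elt x y z w) (u s t)" for s t
    using Q unfolding conj_pair_def u_def by auto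
  ultimately have u: "L.almost_integral (u s t)" if "s\<^sup>2 = 1" "t\<^sup>2 = 1" for s t
    using almost_integral_conj that by blast
  \<comment> \<open>Conjugates that agree on the root of \<open>g * a\<close> are added in pairs:
    the sums are the relative trace and its conjugate.\<close>
  have ga: "2 * x \<in> \<int> \<and> 2 * y \<in> \<int>"
    using squarefree_ga ga_mod Q L.almost_integral_add[OF u[of 1 1] u[of 1 "-1"]]
      L.almost_integral_add[OF u[of "-1" 1] u[of "-1" "-1"]]
    by (intro quadratic_almost_integral[of "g * a"]) (auto simp: u_def elt_def mult.assoc)
  have gb: "2 * x \<in> \<int> \<and> 2 * z \<in> \<int>"
    using squarefree_gb gb_mod Q L.almost_integral_add[OF u[of 1 1] u[of "-1" 1]]
      L.almost_integral_add[OF u[of 1 "-1"] u[of "-1" "-1"]]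
    by (intro quadratic_almost_integral[of "g * b"]) (auto simp: u_def elt_def mult.assoc)
  have ab: "2 * x \<in> \<int> \<and> 2 * w \<in> \<int>"
    using squarefree_ab ab_mod Q L.almost_integral_add[OF u[of 1 1] u[of "-1" "-1"]]
      L.almost_integral_add[OF u[of 1 "-1"] u[of "-1" 1]]
    by (intro quadratic_almost_integral[of "a * b"]) (auto simp: u_def elt_def mult.assoc)
  \<comment> \<open>\<open>E\<close> and \<open>F\<close> are the coordinates of the relative norm
    to the subfield of the root of \<open>g * b\<close>.\<close>
  define E where "E = x\<^sup>2 - g * a * y\<^sup>2 + g * b * z\<^sup>2 - a * b * w\<^sup>2"
  define F where "F = 2 * x * z - 2 * a * y * w"
  have EF: "E \<in> \<rat>" "F \<in> \<rat>" using Q by (auto simp: E_def F_def)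
  have "u 1 1 * u (-1) 1 = E + F * sqrt (real (g * b))"
    unfolding u_def elt_mult E_def F_def by (simp add: elt_def power2_eq_square algebra_simps)
  moreover have "u 1 (-1) * u (-1) (-1) = E - F * sqrt (real (g * b))"
    unfolding u_def elt_mult E_def F_def by (simp add: elt_def power2_eq_square algebra_simps)
  ultimately have "E \<in> \<int>"
    using squarefree_gb gb_mod EF L.almost_integral_mult[OF u[of 1 1] u[of "-1" 1]]
      L.almost_integral_mult[OF u[of 1 "-1"] u[of "-1" "-1"]]
    by (intro conjunct1[OF quadratic_almost_integral[of "g * b" E F]]) auto
  then obtain h k l i j where I: "2 * x = of_int h" "2 * y = of_int k" "2 * z = of_int i"
    "2 * w = of_int l" "E = of_int j"
    using ga gb ab by (auto elim!: Ints_cases)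
  have "of_int (h\<^sup>2 - int (g * a) * k\<^sup>2 + int (g * b) * i\<^sup>2 - int (a * b) * l\<^sup>2)
      = (2 * x)\<^sup>2 - g * a * (2 * y)\<^sup>2 + g * b * (2 * z)\<^sup>2 - a * b * (2 * w)\<^sup>2"
    by (simp add: I)
  also have "\<dots> = of_int (4 * j)"
    unfolding of_int_mult I(5)[symmetric] E_def by (simp add: power2_eq_square algebra_simps)
  finally have eq: "h\<^sup>2 - int (g * a) * k\<^sup>2 + int (g * b) * i\<^sup>2 - int (a * b) * l\<^sup>2 = 4 * j"
    by (simp only: of_int_eq_iff)
  obtain c1 c2 c3 where c: "int (g * a) = 4 * c1 + 2" "int (g * b) = 4 * c2 + 3" "int (a * b) = 4 * c3 + 2"
    using int_eq_4_mult_plus_mod[of "g * a"] int_eq_4_mult_plus_mod[of "g * b"]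
      int_eq_4_mult_plus_mod[of "a * b"] unfolding ga_mod gb_mod ab_mod of_nat_numeral by blast
  \<comment> \<open>\<open>M\<close> collects all multiples of 4, including the
    \<open>4 * i\<^sup>2\<close> left when the coefficient 3 is replaced by -1.\<close>
  define M where "M = j + c1 * k\<^sup>2 - c2 * i\<^sup>2 - i\<^sup>2 + c3 * l\<^sup>2"
  have mod4: "h\<^sup>2 - 2 * k\<^sup>2 - i\<^sup>2 - 2 * l\<^sup>2 = 4 * M"
    using eq unfolding c M_def by (simp add: algebra_simps)
  have "even (k - l)"
    using mod_4_parity_quartic[OF int_square_mod_4 int_square_mod_4 mod4] by simp
  then show ?thesis using that I by blast
qed


section \<open>Sums of squares and the Cauchy-Schwarz bound\<close>

lemma ab_pos: "a * b > 0"
  using ab_mod by (intro Nat.gr0I) simp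

text \<open>\<open>Y\<close> is the sum of squares of the summands' coordinates at the root of
  \<open>g * a\<close>. Smallness of \<open>n\<close> eliminates the coordinates at the root of
  \<open>a * b\<close>, which makes \<open>Y\<close> an integer.\<close>

lemma sqrt_coordinate_gap:
  fixes m n \<kappa> :: nat and xs :: "real list"
  assumes xs: "\<And>u. u \<in> set xs \<Longrightarrow> u \<in> elts \<rat> \<and> algebraic_int u"
    and sum: "(\<Sum>u\<leftarrow>xs. u\<^sup>2) = m * (n + \<kappa> * sqrt (real (g * a)))"
    and small: "4 * m * n \<le> a * b" and pos: "m > 0" "\<kappa> > 0"
    and n: "n < \<kappa> * sqrt (real (g * a)) + 1"
  obtains Y :: nat where "Y > 0" "\<bar>m * \<kappa> / 2 - Y * sqrt (real (g * a))\<bar> < sqrt (real (Y * m))"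
proof -
  define I where "I = {..<length xs}"
  have mem: "xs ! i \<in> elts \<rat> \<and> algebraic_int (xs ! i)" if "i \<in> I" for i
    using xs that by (simp add: I_def)
  then have "\<forall>i\<in>I. \<exists>x y z w. xs ! i = elt x y z w \<and> x \<in> \<rat> \<and> y \<in> \<rat> \<and> z \<in> \<rat> \<and> w \<in> \<rat>"
    by (meson eltsE)
  then obtain x y z w where coord: "\<And>i. i \<in> I \<Longrightarrow> xs ! i = elt (x i) (y i) (z i) (w i)"
    and Q: "\<And>i. i \<in> I \<Longrightarrow> x i \<in> \<rat>" "\<And>i. i \<in> I \<Longrightarrow> y i \<in> \<rat>"
      "\<And>i. i \<in> I \<Longrightarrow> z i \<in> \<rat>" "\<And>i. i \<in> I \<Longrightarrow> w i \<in> \<rat>"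
    by metis
  define s where "s = sqrt (real (g * a))"
  have s2: "s\<^sup>2 = g * a" by (simp add: s_def)
  \<comment> \<open>\<open>f i\<close> and \<open>v i\<close> are the rational part and the
    coordinate at \<open>s\<close> of the square of the \<open>i\<close>-th summand.\<close>
  define f where "f i = x i * x i + g * a * (y i * y i) + g * b * (z i * z i) + a * b * (w i * w i)" for i
  define v where "v i = x i * y i + y i * x i + b * (z i * w i + w i * z i)" for i
  have "(\<Sum>u\<leftarrow>xs. u\<^sup>2) = (\<Sum>i\<in>I. (xs ! i)\<^sup>2)"
    by (simp add: sum_list_sum_nth I_def atLeast0LessThan)
  also have "\<dots> = (\<Sum>i\<in>I. elt (f i) (v i) (x i * z i + z i * x i + a * (y i * w i + w i * y i))
      (x i * w i + w i * x i + g * (y i * z i + z i * y i)))"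
    by (intro sum.cong refl) (simp only: coord power2_eq_square elt_mult f_def v_def)
  finally have "elt (sum f I) (sum v I) (\<Sum>i\<in>I. x i * z i + z i * x i + a * (y i * w i + w i * y i))
      (\<Sum>i\<in>I. x i * w i + w i * x i + g * (y i * z i + z i * y i)) = elt (m * n) (m * \<kappa>) 0 0"
    unfolding sum elt_sum by (simp add: elt_def algebra_simps)
  moreover have "sum f I \<in> \<rat>" "sum v I \<in> \<rat>" "(\<Sum>i\<in>I. x i * z i + z i * x i + a * (y i * w i + w i * y i)) \<in> \<rat>"
    "(\<Sum>i\<in>I. x i * w i + w i * x i + g * (y i * z i + z i * y i)) \<in> \<rat>"
    using Q by (auto simp: f_def v_def intro!: Rats_sum)
  ultimately have f_sum: "sum f I = m * n" and v_sum: "sum v I = m * \<kappa>"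
    using elt_inject[of "sum f I" "sum v I" _ _ "m * n" "m * \<kappa>" 0 0] by auto
  \<comment> \<open>A summand with \<open>w i \<noteq> 0\<close> contributes at least \<open>a b / 4\<close>, and more unless \<open>\<bar>w i\<bar> = 1/2\<close> and \<open>y i = 0\<close>, which the parity excludes.\<close>
  have "w i = 0 \<and> y i \<in> \<int>" if i: "i \<in> I" for i
  proof -
    obtain k l where kl: "2 * y i = of_int k" "2 * w i = of_int l" "even (k - l)"
      using integer_coordinates[of "x i" "y i" "z i" "w i"] Q[OF i] mem[OF i] coord[OF i] by metis
    have "f i \<le> sum f I"
      using i by (intro member_le_sum) (auto simp: f_def I_def)
    moreover have "g * a * (y i * y i) + a * b * (w i * w i) \<le> f i"
      by (simp add: f_def)
    moreover have "4 * real (m * n) \<le> real (a * b)"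
      using of_nat_mono[OF small, where 'a = real] by simp
    moreover have "4 * (g * a * (y i * y i) + a * b * (w i * w i))
        = g * a * ((2 * y i) * (2 * y i)) + a * b * ((2 * w i) * (2 * w i))"
      by (simp add: algebra_simps)
    ultimately have "real (g * a) * (real_of_int k * real_of_int k) + real (a * b) * (real_of_int l * real_of_int l) \<le> real (a * b)"
      unfolding kl f_sum by simp
    then have "real_of_int (int (g * a) * (k * k) + int (a * b) * (l * l)) \<le> real_of_int (int (a * b))"
      by simp
    then have le: "int (g * a) * (k * k) + int (a * b) * (l * l) \<le> int (a * b)"
      by (simp only: of_int_le_iff)
    have ga: "int (g * a) > 0" using ga_mod by (cases "g * a") auto
    have ab: "int (a * b) > 0" using ab_pos by simp
    have "l = 0"
    proof (rule ccontr)
      assume "l \<noteq> 0"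
      then have "1 \<le> l * l" by (metis int_one_le_iff_zero_less not_square_less_zero linorder_neqE_linordered_idom mult_eq_0_iff)
      then have "int (a * b) * 1 \<le> int (a * b) * (l * l)" using ab by (intro mult_left_mono) auto
      then have "int (g * a) * (k * k) \<le> 0" using le by linarith
      then have "k = 0" using ga by (metis mult_le_0_iff not_square_less_zero linorder_not_less mult_eq_0_iff order_antisym zero_le_square)
      \<comment> \<open>A single unit of \<open>l * l\<close> exhausts the bound and leaves
        \<open>k = 0\<close>; parity then raises \<open>l * l\<close> to at least 4.\<close>
      then have "even l" using kl(3) by simp
      then obtain l' where "l = 2 * l'" by (elim evenE)
      with \<open>1 \<le> l * l\<close> have "4 \<le> l * l"
        by (cases "l' * l' \<ge> 1") auto
      then have "int (a * b) * 4 \<le> int (a * b) * (l * l)" using ab by (intro mult_left_mono) auto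
      then show False using le \<open>k = 0\<close> ab by simp
    qed
    moreover from this have "even k" using kl(3) by simp
    then obtain k' where "k = 2 * k'" by (elim evenE)
    then have "y i = of_int k'" using kl(1) by simp
    ultimately show ?thesis using kl(2) by simp
  qed
  then have w: "\<And>i. i \<in> I \<Longrightarrow> w i = 0" and y: "\<And>i. i \<in> I \<Longrightarrow> y i \<in> \<int>" by auto
  have "(\<Sum>i\<in>I. (y i)\<^sup>2) \<in> \<int>" using y by (intro Ints_sum Ints_power)
  moreover have "(\<Sum>i\<in>I. (y i)\<^sup>2) \<ge> 0" by (intro sum_nonneg) simp
  ultimately obtain Y :: nat where Y: "(\<Sum>i\<in>I. (y i)\<^sup>2) = Y"
    by (metis Ints_cases of_int_0_le_iff of_int_of_nat_eq zero_le_imp_eq_int)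
  have v2: "2 * (\<Sum>i\<in>I. x i * y i) = m * \<kappa>"
    unfolding v_sum[symmetric] sum_distrib_left by (intro sum.cong) (auto simp: v_def w)
  have "(\<Sum>i\<in>I. (x i - y i * s)\<^sup>2) = (\<Sum>i\<in>I. x i * x i + g * a * (y i * y i)) - s * (2 * (\<Sum>i\<in>I. x i * y i))"
    unfolding sum_distrib_left sum_subtractf[symmetric] s2[symmetric]
    by (intro sum.cong refl) (simp add: power2_eq_square algebra_simps)
  \<comment> \<open>Discarding the nonnegative contributions of \<open>z\<close> and
    \<open>w\<close> leaves at most the conjugate \<open>m * (n - \<kappa> * s)\<close>, which is
    below \<open>m\<close> by the bound on \<open>n\<close>.\<close>
  also have "\<dots> \<le> sum f I - s * (m * \<kappa>)"
    unfolding v2 by (intro diff_right_mono sum_mono) (simp add: f_def)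
  also have "\<dots> = m * (n - \<kappa> * s)"
    unfolding f_sum by (simp add: algebra_simps)
  also have "\<dots> < real m * 1"
    using n pos by (intro mult_strict_left_mono) (auto simp: s_def)
  finally have T: "(\<Sum>i\<in>I. (x i - y i * s)\<^sup>2) < m" by simp
  have "m * \<kappa> / 2 - Y * s = (\<Sum>i\<in>I. y i * (x i - y i * s))"
    unfolding v2[symmetric] Y[symmetric]
    by (simp add: sum_subtractf sum_distrib_left sum_distrib_right power2_eq_square algebra_simps)
  then have CS: "(m * \<kappa> / 2 - Y * s)\<^sup>2 \<le> Y * (\<Sum>i\<in>I. (x i - y i * s)\<^sup>2)"
    unfolding Y[symmetric] by (simp only: Cauchy_Schwarz_ineq_sum)
  \<comment> \<open>For \<open>Y = 0\<close> the Cauchy-Schwarz bound would make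
    \<open>m * \<kappa> / 2\<close> vanish.\<close>
  have "Y > 0"
    using CS pos by (intro Nat.gr0I) auto
  have "real Y * (\<Sum>i\<in>I. (x i - y i * s)\<^sup>2) < real Y * real m"
    using \<open>Y > 0\<close> by (intro mult_strict_left_mono[OF T]) simp
  with CS have "(m * \<kappa> / 2 - Y * s)\<^sup>2 < real (Y * m)" by simp
  then have "\<bar>m * \<kappa> / 2 - Y * s\<bar> < sqrt (real (Y * m))"
    by (intro real_less_rsqrt) simp
  with \<open>Y > 0\<close> show ?thesis using that by (simp add: s_def)
qed

end

section \<open>The interval \<open>I1\<close>\<close>

text \<open>With \<open>M = m * \<kappa> / 2\<close>, it suffices that \<open>s\<close> lies outside
  the open interval of radius \<open>sqrt (m / Y)\<close> about \<open>M / Y\<close>. For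
  \<open>Y \<ge> t\<close> the lower end of \<open>I1\<close> puts \<open>s\<close> to its right,
  since \<open>M / Y + sqrt (m / Y)\<close> decreases in \<open>Y\<close>; for
  \<open>Y \<le> t - 1\<close> the upper end puts \<open>s\<close> to its left.\<close>

lemma I1_gap:
  assumes "m > 0" "t > 0" "\<kappa> > 0" "s \<in> I1 m t \<kappa>" "Y > 0"
  shows "sqrt (real (Y * m)) \<le> \<bar>real m * real \<kappa> / 2 - real Y * s\<bar>"
proof -
  define c e M where "c = sqrt (real Y)" and "e = sqrt (real m)" and "M = real m * real \<kappa> / 2"
  have c: "c > 0" "real Y = c\<^sup>2" and e: "e > 0" and M: "M > 0"
    using assms by (auto simp: c_def e_def M_def)
  have low: "M / t + e / sqrt (real t) \<le> s"
    using assms by (cases "t = 1") (auto simp: I1_def M_def e_def)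
  show ?thesis
  proof (cases "t \<le> Y")
    case True
    have "M / Y + e / c \<le> M / t + e / sqrt (real t)"
      using True assms M e unfolding c_def by (intro add_mono divide_left_mono) auto
    then have "real Y * (M / Y + e / c) \<le> real Y * s"
      using low by (intro mult_left_mono) auto
    moreover have "real Y * (M / Y + e / c) = M + c * e"
      using c by (simp add: field_simps power2_eq_square)
    ultimately have "c * e \<le> real Y * s - M" by simp
    then show ?thesis by (simp add: c_def e_def M_def real_sqrt_mult)
  next
    case False
    then have t: "t > 1" "real Y \<le> real t - 1" using assms by auto
    define d where "d = sqrt (real t - 1)"
    have d: "d > 0" "real t - 1 = d\<^sup>2" "c \<le> d" using t by (auto simp: d_def c_def)
    have up: "s \<le> M / d\<^sup>2 - e / d"
      using assms t unfolding d(2)[symmetric] by (auto simp: I1_def M_def e_def d_def)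
    have up': "M / d\<^sup>2 - e / d = (M - e * d) / d\<^sup>2"
      using d by (simp add: field_simps power2_eq_square)
    \<comment> \<open>Positivity of the lower end passes to the upper one and gives
      \<open>M - e * d > 0\<close>; only then may \<open>c\<^sup>2 / d\<^sup>2\<close> be bounded by
      1 below.\<close>
    have "0 < M / t + e / sqrt (real t)"
      using M e assms by (intro add_pos_pos divide_pos_pos) auto
    then have "0 < (M - e * d) / d\<^sup>2" using low up up' by linarith
    then have pos: "M - e * d > 0" using d by (simp add: zero_less_divide_iff)
    have "real Y * s \<le> c\<^sup>2 * ((M - e * d) / d\<^sup>2)"
      using up c unfolding up'[symmetric] by (auto intro: mult_left_mono)
    also have "\<dots> = (c\<^sup>2 / d\<^sup>2) * (M - e * d)" by simp
    also have "\<dots> \<le> 1 * (M - e * d)"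
      using pos c d by (intro mult_right_mono) (auto simp: divide_le_eq power_mono)
    also have "\<dots> \<le> M - e * c" using e d by simp
    finally have "c * e \<le> M - real Y * s" by (simp add: mult.commute)
    then show ?thesis by (simp add: c_def e_def M_def real_sqrt_mult)
  qed
qed

text \<open>With \<open>c = sqrt t\<close> and \<open>d = sqrt (t - 1)\<close> the last factor of
  the bound is \<open>(c + d)\<^sup>2\<close>. Taking roots and dividing by
  \<open>2 * c\<^sup>2 * d\<^sup>2\<close> yields the comparison of the two ends.\<close>

lemma I1_nonempty:
  assumes "t > 0" "\<kappa> > 0"
    and m: "real m \<ge> 4 * real t * (real t - 1) * (2 * real t - 1 + 2 * sqrt (real t * (real t - 1))) / (real \<kappa>)\<^sup>2"
  shows "I1 m t \<kappa> \<noteq> {}"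
proof (cases "t > 1")
  case True
  define c d e where "c = sqrt (real t)" and "d = sqrt (real t - 1)" and "e = sqrt (real m)"
  have cd: "c > 0" "d > 0" "e \<ge> 0" "real t = c\<^sup>2" "real t - 1 = d\<^sup>2" "real m = e\<^sup>2"
    using True by (auto simp: c_def d_def e_def)
  have "c\<^sup>2 - d\<^sup>2 = 1" using cd by simp
  have S: "sqrt (real t * (real t - 1)) = c * d" by (simp add: c_def d_def real_sqrt_mult)
  have N: "2 * real t - 1 = c\<^sup>2 + d\<^sup>2" unfolding cd(4,5)[symmetric] by simp
  have "4 * c\<^sup>2 * d\<^sup>2 * (c\<^sup>2 + d\<^sup>2 + 2 * (c * d)) / (real \<kappa>)\<^sup>2 \<le> e\<^sup>2"
    using m unfolding S N unfolding cd(5) unfolding cd(4,6) .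
  then have "(2 * c * d * (c + d))\<^sup>2 \<le> (e * \<kappa>)\<^sup>2"
    using assms(2) by (simp add: field_simps power2_eq_square)
  then have "2 * c * d * (c + d) \<le> e * \<kappa>"
    by (rule power2_le_imp_le) (use cd in auto)
  then have "e * (2 * c * d * (c + d)) \<le> e * (e * \<kappa>)"
    using cd by (intro mult_left_mono) auto
  then have "e * (2 * c * d * (c + d)) / (2 * c\<^sup>2 * d\<^sup>2) \<le> e * (e * \<kappa>) / (2 * c\<^sup>2 * d\<^sup>2)"
    by (rule divide_right_mono) simp
  moreover have "e * (2 * c * d * (c + d)) / (2 * c\<^sup>2 * d\<^sup>2) = e / c + e / d"
    using cd(1,2) by (simp add: add_divide_distrib distrib_left power2_eq_square)
  \<comment> \<open>The factor \<open>1 = c\<^sup>2 - d\<^sup>2\<close> splits the fraction into the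
    main terms of the two ends.\<close>
  moreover have "e * (e * \<kappa>) / (2 * c\<^sup>2 * d\<^sup>2) = e\<^sup>2 * \<kappa> * (c\<^sup>2 - d\<^sup>2) / (2 * c\<^sup>2 * d\<^sup>2)"
    unfolding \<open>c\<^sup>2 - d\<^sup>2 = 1\<close> by (simp add: power2_eq_square)
  moreover have "\<dots> = e\<^sup>2 * \<kappa> / (2 * d\<^sup>2) - e\<^sup>2 * \<kappa> / (2 * c\<^sup>2)"
    using cd(1,2) by (simp add: diff_divide_distrib right_diff_distrib)
  ultimately have "e / c + e / d \<le> e\<^sup>2 * \<kappa> / (2 * d\<^sup>2) - e\<^sup>2 * \<kappa> / (2 * c\<^sup>2)"
    by linarith
  then have "e\<^sup>2 * \<kappa> / (2 * c\<^sup>2) + e / c \<le> e\<^sup>2 * \<kappa> / (2 * d\<^sup>2) - e / d" by linarith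
  then show ?thesis
    using True unfolding I1_def cd(4-6) by (simp add: c_def d_def e_def)
qed (auto simp: I1_def)


section \<open>The field as a subfield of the reals\<close>

lemma inv_real_ring: "x \<noteq> 0 \<Longrightarrow> inv\<^bsub>real_ring\<^esub> x = inverse x"
proof -
  assume "x \<noteq> 0"
  interpret R: field real_ring by (rule field_from_type_algebra)
  show ?thesis
    by (rule R.comm_inv_char) (use \<open>x \<noteq> 0\<close> in \<open>simp_all add: ring_of_type_algebra_def\<close>)
qed

lemma uminus_real_ring: "\<ominus>\<^bsub>real_ring\<^esub> x = - x"
proof -
  interpret R: field real_ring by (rule field_from_type_algebra)
  show ?thesis
    by (rule R.minus_equality) (simp_all add: ring_of_type_algebra_def)
qed

lemma real_ring_ops:
  "x \<oplus>\<^bsub>real_ring\<^esub> y = x + y" "x \<otimes>\<^bsub>real_ring\<^esub> y = x * y"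
  "\<one>\<^bsub>real_ring\<^esub> = 1" "\<zero>\<^bsub>real_ring\<^esub> = 0"
  by (simp_all add: ring_of_type_algebra_def)

text \<open>This supplies rational coordinates for the summands: \<open>elts \<rat>\<close> contains
  both generators and is closed under the field operations.\<close>

lemma (in biquadratic) biquadratic_field_subset: "biquadratic_field (g * a) (g * b) \<subseteq> elts \<rat>"
proof
  fix u assume "u \<in> biquadratic_field (g * a) (g * b)"
  then have "u \<in> generate_field real_ring {sqrt (real (g * a)), sqrt (real (g * b))}"
    by (simp add: biquadratic_field_def)
  then show "u \<in> elts \<rat>"
  proof induction
    case (incl h)
    have "sqrt (real (g * a)) = elt 0 1 0 0" "sqrt (real (g * b)) = elt 0 0 1 0"
      by (simp_all add: elt_def)
    then show ?case using incl by (auto intro: eltsI)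
  qed (auto simp: real_ring_ops uminus_real_ring inv_real_ring intro: Q.one_mem Q.minus_mem Q.add_mem
      Q.mult_mem elts_inverse)
qed

lemma biquadratic_field_closed:
  fixes p q :: nat
  defines "F \<equiv> biquadratic_field p q"
  shows "1 \<in> F" "x \<in> F \<Longrightarrow> y \<in> F \<Longrightarrow> x + y \<in> F" "x \<in> F \<Longrightarrow> y \<in> F \<Longrightarrow> x * y \<in> F"
    "sqrt (real p) \<in> F" "0 \<in> F"
proof -
  note gen = generate_field.intros[where R = real_ring and H = "{sqrt (real p), sqrt (real q)}", unfolded real_ring_ops]
  show "1 \<in> F" "sqrt (real p) \<in> F"
    unfolding F_def biquadratic_field_def using gen by auto
  show "x + y \<in> F" "x * y \<in> F" if "x \<in> F" "y \<in> F"
    using that unfolding F_def biquadratic_field_def using gen by auto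
  have "1 + - 1 \<in> F"
    unfolding F_def biquadratic_field_def using gen uminus_real_ring by metis
  then show "0 \<in> F" by simp
qed

lemma of_nat_mem_biquadratic_field: "real n \<in> biquadratic_field p q"
  by (induction n) (auto intro: biquadratic_field_closed)

text \<open>An embedding fixes the natural numbers, so it sends \<open>sqrt p\<close> to plus or
  minus itself; \<open>n\<close> exceeds \<open>\<kappa> * sqrt p\<close>, so both possible images
  are positive.\<close>

lemma totally_positive_quadratic:
  fixes n \<kappa> p q :: nat
  assumes "n > \<kappa> * sqrt (real p)"
  shows "real n + \<kappa> * sqrt (real p) \<in> totally_positive_integers (biquadratic_field p q)"
proof -
  define F where "F = biquadratic_field p q"
  let ?x = "real n + real \<kappa> * sqrt (real p)"
  have F: "real k \<in> F" "sqrt (real p) \<in> F" for k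
    by (auto simp: F_def intro: of_nat_mem_biquadratic_field biquadratic_field_closed)
  have "algebraic_int ?x"
  proof
    \<comment> \<open>The monic quadratic with roots \<open>n + \<kappa> * sqrt p\<close> and
      \<open>n - \<kappa> * sqrt p\<close>.\<close>
    let ?f = "[:real n ^ 2 - real \<kappa> ^ 2 * real p, - 2 * real n, 1:]"
    show "poly ?f ?x = 0"
      by (simp add: power2_eq_square algebra_simps)
    show "\<forall>i. coeff ?f i \<in> \<int>"
      by (auto simp: coeff_pCons split: nat.splits intro!: Ints_diff Ints_mult Ints_power)
  qed simp
  moreover have "\<sigma> ?x > 0" if \<sigma>: "\<sigma> \<in> real_embeddings F" for \<sigma>
  proof -
    have hom: "\<sigma> (x + y) = \<sigma> x + \<sigma> y" "\<sigma> (x * y) = \<sigma> x * \<sigma> y"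
      if "x \<in> F" "y \<in> F" for x y
      using \<sigma> that by (auto simp: real_embeddings_def ring_hom_def real_ring_ops)
    have one: "\<sigma> 1 = 1"
      using \<sigma> by (simp add: real_embeddings_def ring_hom_def real_ring_ops)
    have "\<sigma> 0 = 0" using hom(1)[of 0 0] F(1)[of 0] by simp
    then have nat: "\<sigma> (real k) = real k" for k
      using hom(1) one by (induction k) (auto simp: of_nat_mem_biquadratic_field biquadratic_field_closed F_def)
    have "(\<sigma> (sqrt (real p)))\<^sup>2 = (sqrt (real p))\<^sup>2"
      using hom(2)[of "sqrt (real p)" "sqrt (real p)"] F nat by (simp add: power2_eq_square)
    then have "\<bar>\<sigma> (sqrt (real p))\<bar> = sqrt (real p)"
      by (metis abs_ge_zero abs_of_nonneg of_nat_0_le_iff power2_eq_iff_nonneg power2_abs real_sqrt_ge_zero)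
    then have "\<kappa> * \<bar>\<sigma> (sqrt (real p))\<bar> < n" using assms by simp
    moreover have "\<bar>\<kappa> * \<sigma> (sqrt (real p))\<bar> = \<kappa> * \<bar>\<sigma> (sqrt (real p))\<bar>"
      by (simp add: abs_mult)
    moreover have "\<sigma> ?x = n + \<kappa> * \<sigma> (sqrt (real p))"
      using hom(1)[of "real n" "real \<kappa> * sqrt (real p)"] hom(2)[of "real \<kappa>" "sqrt (real p)"] F nat
      by (simp add: F_def biquadratic_field_closed)
    ultimately show ?thesis by linarith
  qed
  moreover have "?x \<in> F"
    using F by (simp add: F_def biquadratic_field_closed)
  ultimately show ?thesis
    unfolding F_def totally_positive_integers_def ring_of_integers_def by simp
qed

lemma biquadratic_of_squarefree:
  fixes p q :: nat
  assumes "squarefree p" "squarefree q" "p mod 4 = 2" "q mod 4 = 3"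
  obtains g a b where "biquadratic g a b" "p = g * a" "q = g * b" "p * q div (gcd p q)\<^sup>2 = a * b"
proof -
  define g where "g = gcd p q"
  have "g dvd p" "g dvd q" by (auto simp: g_def)
  then obtain a b where ab: "p = g * a" "q = g * b" by (auto elim!: dvdE)
  have "g > 0" using assms(3) by (auto simp: g_def)
  have "Rings.coprime a b"
    using gcd_mult_distrib_nat[of g a b] \<open>g > 0\<close> unfolding ab[symmetric] g_def[symmetric]
    by (simp add: coprime_iff_gcd_eq_1)
  have "squarefree a" "squarefree b"
    using assms(1,2) ab by (auto dest: squarefree_multD)
  \<comment> \<open>Oddness of \<open>q\<close> passes to \<open>g\<close> and \<open>b\<close>, so
    the factor 2 of \<open>p\<close> lies in \<open>a\<close>; hence \<open>a\<close>, and with it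
    \<open>a * b\<close>, is 2 modulo 4.\<close>
  have "odd q" using assms(4) by presburger
  then have "odd g" "odd b" by (auto simp: ab)
  then have g4: "g mod 4 = 1 \<or> g mod 4 = 3" and b4: "b mod 4 = 1 \<or> b mod 4 = 3" by presburger+
  have a4: "a mod 4 \<in> {0, 1, 2, 3}" by auto
  have "(g mod 4) * (a mod 4) mod 4 = 2"
    using assms(3) by (simp add: ab mod_mult_eq)
  then have "a mod 4 = 2" using g4 a4 by auto
  then have "(a mod 4) * (b mod 4) mod 4 = 2" using b4 by auto
  then have "(a * b) mod 4 = 2" by (simp add: mod_mult_eq)
  then have "biquadratic g a b"
    using assms ab squarefree_mult_coprime[OF \<open>Rings.coprime a b\<close> \<open>squarefree a\<close> \<open>squarefree b\<close>]
    by unfold_locales auto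
  moreover have "p * q div (gcd p q)\<^sup>2 = a * b"
  proof -
    have "p * q = g\<^sup>2 * (a * b)" by (simp add: ab power2_eq_square)
    then show ?thesis using \<open>g > 0\<close> by (simp flip: g_def)
  qed
  ultimately show ?thesis using that ab by blast
qed

section \<open>Choice of the totally positive element and the contradiction\<close>

theorem proposition3p1:
  fixes p q r m t \<kappa> :: nat and K :: "real set"
  assumes "p \<ge> 2" "q \<ge> 2" "squarefree p" "squarefree q"
    and "p mod 4 = 2" "q mod 4 = 3"
    and "r = p * q div (gcd p q)\<^sup>2"
    and "p < q" "q < r"
    and "K = biquadratic_field p q"
    and "m > 0" "t > 0" "\<kappa> > 0"
  shows "(real m \<le> Min {real r / (4 * real_of_int \<lceil>real \<kappa> * sqrt (real r)\<rceil>), real p, real q} \<and>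
          sqrt (real p) \<in> I1 m t \<kappa> \<and> sqrt (real q) \<in> I1 m t \<kappa> \<longrightarrow>
            \<not> (\<lambda>\<alpha>. real m * \<alpha>) ` totally_positive_integers K
              \<subseteq> sums_of_squares (ring_of_integers K)) \<and>
         (real m \<ge> 4 * real t * (real t - 1) * (2 * real t - 1 + 2 * sqrt (real t * (real t - 1)))
                    / (real \<kappa>)\<^sup>2 \<longrightarrow>
            I1 m t \<kappa> \<noteq> {})"
proof (intro conjI impI notI; (elim conjE)?)
  assume m: "real m \<le> Min {real r / (4 * real_of_int \<lceil>real \<kappa> * sqrt (real r)\<rceil>), real p, real q}"
    and p: "sqrt (real p) \<in> I1 m t \<kappa>"
    and sub: "(\<lambda>\<alpha>. real m * \<alpha>) ` totally_positive_integers K \<subseteq> sums_of_squares (ring_of_integers K)"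
  obtain g a b where "biquadratic g a b" and pq: "p = g * a" "q = g * b" and r: "r = a * b"
    using biquadratic_of_squarefree[OF assms(3-6)] assms(7) by metis
  then interpret biquadratic g a b by simp
  \<comment> \<open>The ceiling puts \<open>n - \<kappa> * sqrt p\<close> strictly between 0 and 1:
    positivity, from irrationality, gives total positivity, and the upper bound feeds the
    Cauchy-Schwarz estimate.\<close>
  define n where "n = nat \<lceil>\<kappa> * sqrt (real p)\<rceil>"
  have n: "real n = of_int \<lceil>\<kappa> * sqrt (real p)\<rceil>"
    by (simp add: n_def)
  have "real n \<noteq> \<kappa> * sqrt (real p)"
  proof
    assume "real n = \<kappa> * sqrt (real p)"
    then have "sqrt (real p) = real n / real \<kappa>" using assms(13) by (simp add: field_simps)
    then have "sqrt (real p) \<in> \<rat>" by simp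
    then show False using sqrt_not_Rats[of p] assms(5) by simp
  qed
  then have n_gt: "n > \<kappa> * sqrt (real p)"
    using n le_of_int_ceiling[of "\<kappa> * sqrt (real p)"] by linarith
  have n_less: "n < \<kappa> * sqrt (real p) + 1"
    unfolding n by linarith
  define c where "c = \<lceil>\<kappa> * sqrt (real r)\<rceil>"
  \<comment> \<open>Since \<open>p < r\<close>, the ceiling \<open>c\<close> in the bound on
    \<open>m\<close> dominates \<open>n\<close>, which gives
    \<open>4 * m * n \<le> r\<close>.\<close>
  have "\<kappa> * sqrt (real p) \<le> \<kappa> * sqrt (real r)"
    using assms by (intro mult_left_mono) auto
  then have "real n \<le> of_int c"
    unfolding n c_def by (simp add: ceiling_mono)
  moreover have "0 < \<kappa> * sqrt (real r)" using assms by simp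
  then have "c > 0" unfolding c_def by simp
  moreover have "real m \<le> r / (4 * of_int c)"
    using m by (simp add: c_def)
  ultimately have "real (4 * m * n) \<le> real r"
  proof -
    have "real (4 * m * n) \<le> real m * (4 * of_int c)"
      using \<open>real n \<le> of_int c\<close> by (simp add: mult_left_mono)
    also have "\<dots> \<le> r"
      using \<open>real m \<le> r / (4 * of_int c)\<close> \<open>c > 0\<close> by (simp add: field_simps)
    finally show ?thesis .
  qed
  then have small: "4 * m * n \<le> a * b" unfolding r of_nat_le_iff .
  have "real m * (n + \<kappa> * sqrt (real p)) \<in> sums_of_squares (ring_of_integers K)"
    using sub totally_positive_quadratic[OF n_gt, of q] assms(10) by blast
  then obtain xs where xs: "set xs \<subseteq> ring_of_integers K"
    and sum: "(\<Sum>u\<leftarrow>xs. u\<^sup>2) = m * (n + \<kappa> * sqrt (real p))"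
    unfolding sums_of_squares_def by (auto simp del: of_nat_add of_nat_mult)
  have mem: "u \<in> elts \<rat> \<and> algebraic_int u" if "u \<in> set xs" for u
    using that xs biquadratic_field_subset assms(10) pq by (auto simp: ring_of_integers_def)
  obtain Y :: nat where "Y > 0" "\<bar>m * \<kappa> / 2 - Y * sqrt (real p)\<bar> < sqrt (real (Y * m))"
    using sqrt_coordinate_gap[OF mem sum[unfolded pq] small assms(11,13) n_less[unfolded pq]]
    unfolding pq by blast
  then show False
    using I1_gap[OF assms(11,12,13) p \<open>Y > 0\<close>] by simp
next
  assume "real m \<ge> 4 * real t * (real t - 1) * (2 * real t - 1 + 2 * sqrt (real t * (real t - 1))) / (real \<kappa>)\<^sup>2"
  moreover assume "I1 m t \<kappa> = {}"
  ultimately show False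
    using I1_nonempty assms by blast
qed

end
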